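(* Let $C,L_1,L_2,R>0$, let $0<I_{\min}<I_{\max}$, $K=[I_{\min},I_{\max}]$, and let $V_{\rm ref}\in[RI_{\min},RI_{\max}]$. Then, for all initial data $(V_C(0),I_1(0),I_2(0),I(0))\in\mathbb R^2\times[0,+\infty)\times K$, the corresponding solution to the closed-loop system $$\dot V_C=-\tfrac{1}{C}I_1+\tfrac1C I,\qquad \dot I_1=\tfrac{1}{L_1}V_C-\tfrac{R}{L_1}(I_1+I_2),$$ $$\dot I_2\in-\tfrac{R}{L_2}(I_1+I_2)-\tfrac1{L_2}N_{[0,+\infty)}(I_2),\qquad \dot I\in-N_K(I)+V_{\rm ref}-V_C$$ satisfies $$(V_C(t),I_1(t),I_2(t),I(t))\to\Big(V_{\rm ref},\tfrac1R V_{\rm ref},0,\tfrac1R V_{\rm ref}\Big)\quad\text{as }t\to+\infty.$$ Moreover, $I(t)\in[I_{\min},I_{\max}]$ for all $t\ge0$.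
   Context: For a closed convex set $S\subset\mathbb R$, the normal cone is $N_S(z)=\{w\in\mathbb R: w(z-y)\ge0\ \forall y\in S\}$ for $z\in S$ and $N_S(z)=\emptyset$ for $z\notin S$. A (strong) solution is a function $[0,+\infty)\to\mathbb R^2\times[0,+\infty)\times K$ that is absolutely continuous on each $[0,T]$ and satisfies the differential inclusions almost everywhere; for each initial datum in $\mathbb R^2\times[0,+\infty)\times K$ there is a unique such solution. *)

theory Defs
  imports "HOL-Analysis.Analysis"
begin

definition normal_cone :: "real set \<Rightarrow> real \<Rightarrow> real set" where
  "normal_cone S z = (if z \<in> S then {w. \<forall>y\<in>S. w * (z - y) \<ge> 0} else {})"

(* A pair (u, v) stands for the interval with endpoints u \<le> v. *)
definition abs_continuous_on_interval ::
    "real \<Rightarrow> real \<Rightarrow> (real \<Rightarrow> 'a::real_normed_vector) \<Rightarrow> bool" where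
  "abs_continuous_on_interval a b f \<longleftrightarrow>
     (\<forall>\<epsilon>>0. \<exists>\<delta>>0. \<forall>D :: (real \<times> real) set.
        finite D \<and>
        (\<forall>(u, v)\<in>D. a \<le> u \<and> u \<le> v \<and> v \<le> b) \<and>
        pairwise (\<lambda>(u, v) (u', v'). {u<..<v} \<inter> {u'<..<v'} = {}) D \<and>
        (\<Sum>(u, v)\<in>D. v - u) < \<delta>
        \<longrightarrow> (\<Sum>(u, v)\<in>D. norm (f v - f u)) < \<epsilon>)"

(* Strong solutions on [0, \<infinity>) with values in D of the inclusion x' \<in> F x, x 0 = x0.
   The values of x at negative times are irrelevant. *)
definition strong_solution ::
    "('a::real_normed_vector \<Rightarrow> 'a set) \<Rightarrow> 'a set \<Rightarrow> 'a \<Rightarrow> (real \<Rightarrow> 'a) \<Rightarrow> bool" where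
  "strong_solution F D x0 x \<longleftrightarrow>
     x 0 = x0 \<and>
     (\<forall>t\<ge>0. x t \<in> D) \<and>
     (\<forall>T\<ge>0. abs_continuous_on_interval 0 T x) \<and>
     (AE t in lebesgue. t \<ge> 0 \<longrightarrow>
        (\<exists>d. (x has_vector_derivative d) (at t within {0..}) \<and> d \<in> F (x t)))"

(* State (V_C, I_1, I_2, I); the four components of the right-hand side are in the same order. *)
definition closed_loop ::
    "real \<Rightarrow> real \<Rightarrow> real \<Rightarrow> real \<Rightarrow> real set \<Rightarrow> real \<Rightarrow>
     real \<times> real \<times> real \<times> real \<Rightarrow> (real \<times> real \<times> real \<times> real) set" where
  "closed_loop C L\<^sub>1 L\<^sub>2 R K V\<^sub>r\<^sub>e\<^sub>f = (\<lambda>(v, i\<^sub>1, i\<^sub>2, i).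
     {(- (1 / C) * i\<^sub>1 + (1 / C) * i,
       (1 / L\<^sub>1) * v - (R / L\<^sub>1) * (i\<^sub>1 + i\<^sub>2),
       - (R / L\<^sub>2) * (i\<^sub>1 + i\<^sub>2) - (1 / L\<^sub>2) * \<nu>,
       - \<mu> + V\<^sub>r\<^sub>e\<^sub>f - v) | \<nu> \<mu>. \<nu> \<in> normal_cone {0..} i\<^sub>2 \<and> \<mu> \<in> normal_cone K i})"

end

theory Submission
  imports Defs
begin

text \<open>
The proof is an energy argument. Let \<open>i = V\<^sub>r\<^sub>e\<^sub>f / R\<close> be the equilibrium current. The energy
\<open>E = (C (V\<^sub>C - V\<^sub>r\<^sub>e\<^sub>f)\<^sup>2 + L\<^sub>1 (I\<^sub>1 - i)\<^sup>2 + L\<^sub>2 I\<^sub>2\<^sup>2 + (I - i)\<^sup>2) / 2\<close> satisfies, almost everywhere,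
\<open>E' \<le> - R (I\<^sub>1 - i + I\<^sub>2)\<^sup>2 - V\<^sub>r\<^sub>e\<^sub>f I\<^sub>2\<close>: the skew-symmetric couplings cancel, and the normal
cones only take energy out, because \<open>0\<close> lies in the half-line and \<open>i\<close> lies in \<open>K\<close>. So \<open>E\<close>
decreases, the solution is bounded, and two nonnegative quantities, \<open>V\<^sub>r\<^sub>e\<^sub>f I\<^sub>2\<close> and
\<open>R (I\<^sub>1 - i + I\<^sub>2)\<^sup>2\<close>, have finite integral over the half-line.

No invariance principle for differential inclusions is used; four applications of a Barbalat
argument suffice. It needs Lipschitz bounds on the components. Although the normal cones are
unbounded, the velocities are bounded: at a point of differentiability the constraint force is
orthogonal to the velocity (lemma \<open>normal_cone_orthogonal_velocity\<close>), so in one dimension a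
velocity is either zero or equal to its unconstrained value. Dissipation then gives
\<open>I\<^sub>2 \<rightarrow> 0\<close> and \<open>I\<^sub>1 \<rightarrow> i\<close> (lemma \<open>nonneg_dissipation_tendsto_zero\<close>). As \<open>I\<^sub>1\<close> converges and has the
Lipschitz derivative \<open>(V\<^sub>C - R (I\<^sub>1 + I\<^sub>2)) / L\<^sub>1\<close>, that derivative tends to \<open>0\<close>, whence
\<open>V\<^sub>C \<rightarrow> V\<^sub>r\<^sub>e\<^sub>f\<close>; in the same way the convergence of \<open>V\<^sub>C\<close> gives \<open>I - I\<^sub>1 \<rightarrow> 0\<close> (lemma
\<open>barbalat_abs_continuous\<close>).

All differential inequalities hold almost everywhere only. They are integrated with
\<open>abs_continuous_derivative_nonpos\<close>: an absolutely continuous function whose derivative is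
nonpositive almost everywhere does not increase.
\<close>

section \<open>Absolutely continuous functions\<close>

lemma abs_continuous_on_intervalE:
  assumes "abs_continuous_on_interval a b f" "0 < \<epsilon>"
  obtains \<delta> where "0 < \<delta>"
    "\<And>D. finite D \<Longrightarrow> (\<And>u v. (u, v) \<in> D \<Longrightarrow> a \<le> u \<and> u \<le> v \<and> v \<le> b) \<Longrightarrow>
       pairwise (\<lambda>(u, v) (u', v'). {u<..<v} \<inter> {u'<..<v'} = {}) D \<Longrightarrow>
       (\<Sum>(u, v)\<in>D. v - u) < \<delta> \<Longrightarrow> (\<Sum>(u, v)\<in>D. norm (f v - f u)) < \<epsilon>"
proof -
  from assms obtain \<delta> where "0 < \<delta>" and \<delta>: "\<forall>D :: (real \<times> real) set.
        finite D \<and>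
        (\<forall>(u, v)\<in>D. a \<le> u \<and> u \<le> v \<and> v \<le> b) \<and>
        pairwise (\<lambda>(u, v) (u', v'). {u<..<v} \<inter> {u'<..<v'} = {}) D \<and>
        (\<Sum>(u, v)\<in>D. v - u) < \<delta>
        \<longrightarrow> (\<Sum>(u, v)\<in>D. norm (f v - f u)) < \<epsilon>"
    unfolding abs_continuous_on_interval_def by meson
  show thesis
    by (rule that[OF \<open>0 < \<delta>\<close>], rule \<delta>[rule_format]) auto
qed

lemma abs_continuous_on_intervalI:
  assumes "\<And>\<epsilon>. 0 < \<epsilon> \<Longrightarrow> \<exists>\<delta>>0. \<forall>D :: (real \<times> real) set.
        finite D \<longrightarrow>
        (\<forall>(u, v)\<in>D. a \<le> u \<and> u \<le> v \<and> v \<le> b) \<longrightarrow>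
        pairwise (\<lambda>(u, v) (u', v'). {u<..<v} \<inter> {u'<..<v'} = {}) D \<longrightarrow>
        (\<Sum>(u, v)\<in>D. v - u) < \<delta> \<longrightarrow> (\<Sum>(u, v)\<in>D. norm (f v - f u)) < \<epsilon>"
  shows "abs_continuous_on_interval a b f"
  unfolding abs_continuous_on_interval_def imp_conjL by (intro allI impI assms)

lemma abs_continuous_on_interval_subset:
  assumes "abs_continuous_on_interval a b f" "a \<le> a'" "b' \<le> b"
  shows "abs_continuous_on_interval a' b' f"
proof (rule abs_continuous_on_intervalI)
  fix \<epsilon> :: real assume "0 < \<epsilon>"
  obtain \<delta> where d: "0 < \<delta>"
    and D: "\<And>D. finite D \<Longrightarrow> (\<And>u v. (u, v) \<in> D \<Longrightarrow> a \<le> u \<and> u \<le> v \<and> v \<le> b) \<Longrightarrow>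
       pairwise (\<lambda>(u, v) (u', v'). {u<..<v} \<inter> {u'<..<v'} = {}) D \<Longrightarrow>
       (\<Sum>(u, v)\<in>D. v - u) < \<delta> \<Longrightarrow> (\<Sum>(u, v)\<in>D. norm (f v - f u)) < \<epsilon>"
    using abs_continuous_on_intervalE[OF assms(1) \<open>0 < \<epsilon>\<close>] by blast
  show "\<exists>\<delta>>0. \<forall>D :: (real \<times> real) set.
        finite D \<longrightarrow>
        (\<forall>(u, v)\<in>D. a' \<le> u \<and> u \<le> v \<and> v \<le> b') \<longrightarrow>
        pairwise (\<lambda>(u, v) (u', v'). {u<..<v} \<inter> {u'<..<v'} = {}) D \<longrightarrow>
        (\<Sum>(u, v)\<in>D. v - u) < \<delta> \<longrightarrow> (\<Sum>(u, v)\<in>D. norm (f v - f u)) < \<epsilon>"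
    by (rule exI[of _ \<delta>], intro conjI d allI impI D) (use assms in fastforce)+
qed

lemma abs_continuous_on_interval_continuous:
  assumes "abs_continuous_on_interval a b f"
  shows "continuous_on {a..b} f"
proof (rule continuous_on_iff[THEN iffD2], intro ballI allI impI)
  fix x and \<epsilon> :: real assume x: "x \<in> {a..b}" and "0 < \<epsilon>"
  obtain \<delta> where d: "0 < \<delta>"
    and D: "\<And>D. finite D \<Longrightarrow> (\<And>u v. (u, v) \<in> D \<Longrightarrow> a \<le> u \<and> u \<le> v \<and> v \<le> b) \<Longrightarrow>
       pairwise (\<lambda>(u, v) (u', v'). {u<..<v} \<inter> {u'<..<v'} = {}) D \<Longrightarrow>
       (\<Sum>(u, v)\<in>D. v - u) < \<delta> \<Longrightarrow> (\<Sum>(u, v)\<in>D. norm (f v - f u)) < \<epsilon>"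
    using abs_continuous_on_intervalE[OF assms(1) \<open>0 < \<epsilon>\<close>] by blast
  have close: "norm (f v - f u) < \<epsilon>" if "a \<le> u" "u \<le> v" "v \<le> b" "v - u < \<delta>" for u v
    using D[of "{(u, v)}"] that by simp
  have "dist (f y) (f x) < \<epsilon>" if "y \<in> {a..b}" "dist y x < \<delta>" for y
  proof (cases "x \<le> y")
    case True
    then show ?thesis using close[of x y] that x by (simp add: dist_norm)
  next
    case False
    then show ?thesis using close[of y x] that x by (simp add: dist_norm norm_minus_commute)
  qed
  with d show "\<exists>\<delta>>0. \<forall>y\<in>{a..b}. dist y x < \<delta> \<longrightarrow> dist (f y) (f x) < \<epsilon>" by blast
qed

text \<open>Lipschitz continuity is required on the range of the inner function alone, so that the lemma
  covers the square, which is Lipschitz on bounded sets only.\<close>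

lemma abs_continuous_on_interval_lipschitz_comp:
  assumes ac: "abs_continuous_on_interval a b f" and L: "L-lipschitz_on (f ` {a..b}) g"
  shows "abs_continuous_on_interval a b (\<lambda>t. g (f t))"
proof (rule abs_continuous_on_intervalI)
  fix \<epsilon> :: real assume "0 < \<epsilon>"
  have "0 \<le> L" using L by (rule lipschitz_on_nonneg)
  then have e: "0 < \<epsilon> / (L + 1)" using \<open>0 < \<epsilon>\<close> by simp
  obtain \<delta> where d: "0 < \<delta>"
    and D: "\<And>D. finite D \<Longrightarrow> (\<And>u v. (u, v) \<in> D \<Longrightarrow> a \<le> u \<and> u \<le> v \<and> v \<le> b) \<Longrightarrow>
       pairwise (\<lambda>(u, v) (u', v'). {u<..<v} \<inter> {u'<..<v'} = {}) D \<Longrightarrow>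
       (\<Sum>(u, v)\<in>D. v - u) < \<delta> \<Longrightarrow> (\<Sum>(u, v)\<in>D. norm (f v - f u)) < \<epsilon> / (L + 1)"
    using abs_continuous_on_intervalE[OF ac e] by blast
  have "(\<Sum>(u, v)\<in>D. norm (g (f v) - g (f u))) < \<epsilon>"
    if "finite D" "\<forall>(u, v)\<in>D. a \<le> u \<and> u \<le> v \<and> v \<le> b"
       "pairwise (\<lambda>(u, v) (u', v'). {u<..<v} \<inter> {u'<..<v'} = {}) D"
       "(\<Sum>(u, v)\<in>D. v - u) < \<delta>" for D
  proof -
    have "(\<Sum>(u, v)\<in>D. norm (g (f v) - g (f u))) \<le> (\<Sum>(u, v)\<in>D. (L + 1) * norm (f v - f u))"
    proof (rule sum_mono, clarify)
      fix u v assume "(u, v) \<in> D"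
      with that(2) have "f u \<in> f ` {a..b}" "f v \<in> f ` {a..b}" by auto
      then have "norm (g (f v) - g (f u)) \<le> L * norm (f v - f u)"
        using lipschitz_on_normD[OF L] by blast
      also have "\<dots> \<le> (L + 1) * norm (f v - f u)" by (simp add: mult_right_mono)
      finally show "norm (g (f v) - g (f u)) \<le> (L + 1) * norm (f v - f u)" .
    qed
    also have "\<dots> = (L + 1) * (\<Sum>(u, v)\<in>D. norm (f v - f u))"
      by (simp add: sum_distrib_left case_prod_beta)
    also have "\<dots> < (L + 1) * (\<epsilon> / (L + 1))"
      using D[of D] that \<open>0 \<le> L\<close> by (intro mult_strict_left_mono) auto
    finally show ?thesis using \<open>0 \<le> L\<close> by simp
  qed
  with d show "\<exists>\<delta>>0. \<forall>D :: (real \<times> real) set.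
        finite D \<longrightarrow>
        (\<forall>(u, v)\<in>D. a \<le> u \<and> u \<le> v \<and> v \<le> b) \<longrightarrow>
        pairwise (\<lambda>(u, v) (u', v'). {u<..<v} \<inter> {u'<..<v'} = {}) D \<longrightarrow>
        (\<Sum>(u, v)\<in>D. v - u) < \<delta> \<longrightarrow> (\<Sum>(u, v)\<in>D. norm (g (f v) - g (f u))) < \<epsilon>"
    by blast
qed

lemma abs_continuous_on_interval_add:
  assumes f: "abs_continuous_on_interval a b f" and g: "abs_continuous_on_interval a b g"
  shows "abs_continuous_on_interval a b (\<lambda>t. f t + g t)"
proof (rule abs_continuous_on_intervalI)
  fix \<epsilon> :: real assume "0 < \<epsilon>"
  then have e: "0 < \<epsilon> / 2" by simp
  obtain \<delta> where d: "0 < \<delta>"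
    and D: "\<And>D. finite D \<Longrightarrow> (\<And>u v. (u, v) \<in> D \<Longrightarrow> a \<le> u \<and> u \<le> v \<and> v \<le> b) \<Longrightarrow>
       pairwise (\<lambda>(u, v) (u', v'). {u<..<v} \<inter> {u'<..<v'} = {}) D \<Longrightarrow>
       (\<Sum>(u, v)\<in>D. v - u) < \<delta> \<Longrightarrow> (\<Sum>(u, v)\<in>D. norm (f v - f u)) < \<epsilon> / 2"
    using abs_continuous_on_intervalE[OF f e] by blast
  obtain \<delta>' where d': "0 < \<delta>'"
    and D': "\<And>D. finite D \<Longrightarrow> (\<And>u v. (u, v) \<in> D \<Longrightarrow> a \<le> u \<and> u \<le> v \<and> v \<le> b) \<Longrightarrow>
       pairwise (\<lambda>(u, v) (u', v'). {u<..<v} \<inter> {u'<..<v'} = {}) D \<Longrightarrow>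
       (\<Sum>(u, v)\<in>D. v - u) < \<delta>' \<Longrightarrow> (\<Sum>(u, v)\<in>D. norm (g v - g u)) < \<epsilon> / 2"
    using abs_continuous_on_intervalE[OF g e] by blast
  have "(\<Sum>(u, v)\<in>D. norm (f v + g v - (f u + g u))) < \<epsilon>"
    if "finite D" "\<forall>(u, v)\<in>D. a \<le> u \<and> u \<le> v \<and> v \<le> b"
       "pairwise (\<lambda>(u, v) (u', v'). {u<..<v} \<inter> {u'<..<v'} = {}) D"
       "(\<Sum>(u, v)\<in>D. v - u) < min \<delta> \<delta>'" for D
  proof -
    have "(\<Sum>(u, v)\<in>D. norm (f v + g v - (f u + g u)))
        \<le> (\<Sum>(u, v)\<in>D. norm (f v - f u) + norm (g v - g u))"
      by (intro sum_mono) (auto simp: add_diff_add norm_triangle_ineq)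
    also have "\<dots> = (\<Sum>(u, v)\<in>D. norm (f v - f u)) + (\<Sum>(u, v)\<in>D. norm (g v - g u))"
      by (simp add: sum.distrib case_prod_beta)
    also have "\<dots> < \<epsilon> / 2 + \<epsilon> / 2"
      using D[of D] D'[of D] that by (intro add_strict_mono) auto
    finally show ?thesis by simp
  qed
  with d d' show "\<exists>\<delta>>0. \<forall>D :: (real \<times> real) set.
        finite D \<longrightarrow>
        (\<forall>(u, v)\<in>D. a \<le> u \<and> u \<le> v \<and> v \<le> b) \<longrightarrow>
        pairwise (\<lambda>(u, v) (u', v'). {u<..<v} \<inter> {u'<..<v'} = {}) D \<longrightarrow>
        (\<Sum>(u, v)\<in>D. v - u) < \<delta> \<longrightarrow> (\<Sum>(u, v)\<in>D. norm (f v + g v - (f u + g u))) < \<epsilon>"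
    by (intro exI[of _ "min \<delta> \<delta>'"]) simp
qed

lemma abs_continuous_on_interval_id: "abs_continuous_on_interval a b (\<lambda>t :: real. t)"
  unfolding abs_continuous_on_interval_def
proof (intro allI impI)
  fix \<epsilon> :: real assume "0 < \<epsilon>"
  have "(\<Sum>(u, v)\<in>D. norm (v - u)) < \<epsilon>"
    if "\<forall>(u, v)\<in>D. a \<le> u \<and> u \<le> v \<and> v \<le> b" "(\<Sum>(u, v)\<in>D. v - u) < \<epsilon>" for D :: "(real \<times> real) set"
  proof -
    have "(\<Sum>(u, v)\<in>D. norm (v - u)) = (\<Sum>(u, v)\<in>D. v - u)"
      using that(1) by (intro sum.cong) auto
    with that(2) show ?thesis by simp
  qed
  with \<open>0 < \<epsilon>\<close> show "\<exists>\<delta>>0. \<forall>D :: (real \<times> real) set.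
      finite D \<and> (\<forall>(u, v)\<in>D. a \<le> u \<and> u \<le> v \<and> v \<le> b) \<and>
      pairwise (\<lambda>(u, v) (u', v'). {u<..<v} \<inter> {u'<..<v'} = {}) D \<and>
      (\<Sum>(u, v)\<in>D. v - u) < \<delta> \<longrightarrow> (\<Sum>(u, v)\<in>D. norm (v - u)) < \<epsilon>"
    by blast
qed

lemma abs_continuous_on_interval_affine:
  fixes f :: "real \<Rightarrow> real"
  assumes "abs_continuous_on_interval a b f"
  shows "abs_continuous_on_interval a b (\<lambda>t. c * f t + k)"
  by (rule abs_continuous_on_interval_lipschitz_comp[OF assms, of "\<bar>c\<bar>" "\<lambda>x. c * x + k"])
    (auto intro!: lipschitz_onI simp: dist_norm simp flip: right_diff_distrib abs_mult)

lemma lipschitz_on_power2: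
  assumes "0 \<le> M"
  shows "(2 * M)-lipschitz_on {- M..M} (\<lambda>x :: real. x\<^sup>2)"
proof (rule lipschitz_onI)
  fix x y assume "x \<in> {- M..M}" "y \<in> {- M..M}"
  then have "\<bar>x + y\<bar> \<le> 2 * M" by auto
  then show "dist (x\<^sup>2) (y\<^sup>2) \<le> 2 * M * dist x y"
    by (simp add: dist_real_def square_diff_square_factored power2_eq_square abs_mult mult_right_mono)
qed (use assms in simp)

lemma abs_continuous_on_interval_power2:
  fixes f :: "real \<Rightarrow> real"
  assumes "abs_continuous_on_interval a b f"
  shows "abs_continuous_on_interval a b (\<lambda>t. (f t)\<^sup>2)"
proof -
  have "compact (f ` {a..b})"
    using abs_continuous_on_interval_continuous[OF assms] by (rule compact_continuous_image) simp
  then obtain M where M: "\<And>x. x \<in> f ` {a..b} \<Longrightarrow> \<bar>x\<bar> \<le> M" and "0 < M"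
    by (metis compact_imp_bounded bounded_pos real_norm_def)
  have "(2 * M)-lipschitz_on (f ` {a..b}) (\<lambda>x. x\<^sup>2)"
    using \<open>0 < M\<close> M by (intro lipschitz_on_subset[OF lipschitz_on_power2]) (fastforce simp: abs_le_iff)+
  with assms show ?thesis by (rule abs_continuous_on_interval_lipschitz_comp)
qed

section \<open>Integrating differential inequalities that hold almost everywhere\<close>

text \<open>The slope is controlled over intervals that contain the point but need not have it as an
  endpoint: this is what a tagged division provides.\<close>

lemma derivative_nonpos_straddle:
  fixes f :: "real \<Rightarrow> real"
  assumes "(f has_real_derivative d) (at x)" "d \<le> 0" "0 < \<epsilon>"
  obtains r where "0 < r"
    "\<And>u v. u \<in> ball x r \<Longrightarrow> v \<in> ball x r \<Longrightarrow> u \<le> x \<Longrightarrow> x \<le> v \<Longrightarrow> f v - f u \<le> \<epsilon> * (v - u)"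
proof -
  from assms(1,3) obtain r where "0 < r"
    and r: "\<And>y. norm (y - x) < r \<Longrightarrow> norm (f y - f x - d * (y - x)) \<le> \<epsilon> * norm (y - x)"
    unfolding has_field_derivative_def has_derivative_at_alt by blast
  show thesis
  proof (rule that[OF \<open>0 < r\<close>])
    fix u v assume uv: "u \<in> ball x r" "v \<in> ball x r" "u \<le> x" "x \<le> v"
    have "f v - f x - d * (v - x) \<le> \<epsilon> * (v - x)" "f x - f u + d * (u - x) \<le> \<epsilon> * (x - u)"
      using r[of v] r[of u] uv by (auto simp: dist_real_def abs_le_iff)
    moreover have "d * (v - x) \<le> 0" "0 \<le> d * (u - x)"
      using uv \<open>d \<le> 0\<close> by (auto simp: mult_nonpos_nonneg mult_nonpos_nonpos)
    ultimately show "f v - f u \<le> \<epsilon> * (v - u)" by (simp add: algebra_simps)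
  qed
qed

text \<open>The exceptional null set \<open>N\<close> is covered by an open set \<open>U\<close> of measure less than \<open>\<delta>\<close>. Choose a
  gauge that keeps the intervals tagged in \<open>N\<close> inside \<open>U\<close> and makes the increment of \<open>f\<close> over the
  other ones at most \<open>\<epsilon>\<close> times their length. By Cousin's lemma the gauge has a fine tagged division;
  absolute continuity makes the increments over the intervals of the first kind add up to less
  than \<open>\<epsilon>\<close>. This avoids the Lebesgue integral of the derivative and the Vitali covering theorem.\<close>

lemma abs_continuous_derivative_nonpos:
  fixes f :: "real \<Rightarrow> real"
  assumes ac: "abs_continuous_on_interval a b f" and "a \<le> b"
    and ae: "AE x in lebesgue. x \<in> {a<..<b} \<longrightarrow> (\<exists>d\<le>0. (f has_real_derivative d) (at x))"
  shows "f b \<le> f a"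
proof -
  \<comment> \<open>The endpoints join the null set because derivatives are given at interior points only.\<close>
  define N where "N = {x \<in> {a<..<b}. \<not> (\<exists>d\<le>0. (f has_real_derivative d) (at x))} \<union> {a, b}"
  have "{x \<in> {a<..<b}. \<not> (\<exists>d\<le>0. (f has_real_derivative d) (at x))} \<in> null_sets lebesgue"
    using ae unfolding eventually_ae_filter
    by (auto intro: completion.complete_sets_sandwich elim!: null_sets_completion_subset[rotated])
  then have N0: "N \<in> null_sets lebesgue"
    unfolding N_def by (intro null_sets.Un) (auto simp flip: negligible_iff_null_sets)
  have small: "f b - f a \<le> \<epsilon> * (b - a) + \<epsilon>" if "0 < \<epsilon>" for \<epsilon>
  proof -
    obtain \<delta> where d: "0 < \<delta>"
      and D: "\<And>D. finite D \<Longrightarrow> (\<And>u v. (u, v) \<in> D \<Longrightarrow> a \<le> u \<and> u \<le> v \<and> v \<le> b) \<Longrightarrow>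
         pairwise (\<lambda>(u, v) (u', v'). {u<..<v} \<inter> {u'<..<v'} = {}) D \<Longrightarrow>
         (\<Sum>(u, v)\<in>D. v - u) < \<delta> \<Longrightarrow> (\<Sum>(u, v)\<in>D. norm (f v - f u)) < \<epsilon>"
      using abs_continuous_on_intervalE[OF ac \<open>0 < \<epsilon>\<close>] by blast
    obtain U where U: "open U" "N \<subseteq> U" "U - N \<in> lmeasurable" "emeasure lebesgue (U - N) < ennreal \<delta>"
      using sets_lebesgue_outer_open[of N \<delta>] N0 d by blast
    have Um: "U \<in> lmeasurable" "measure lebesgue U < \<delta>"
    proof -
      have "emeasure lebesgue U = emeasure lebesgue (U - N)"
        using emeasure_Diff_null_set[OF N0, of U] U(1) by simp
      with U d show "U \<in> lmeasurable" "measure lebesgue U < \<delta>"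
        by (auto simp: fmeasurable_def measure_def less_top[symmetric] enn2real_less_iff
            intro: less_trans ennreal_less_top)
    qed
    have "\<exists>r>0. (x \<in> N \<longrightarrow> ball x r \<subseteq> U) \<and> (x \<in> {a..b} - N \<longrightarrow>
        (\<forall>u v. u \<in> ball x r \<longrightarrow> v \<in> ball x r \<longrightarrow> u \<le> x \<longrightarrow> x \<le> v \<longrightarrow> f v - f u \<le> \<epsilon> * (v - u)))" for x
    proof (cases "x \<in> N")
      case True
      with U(1,2) show ?thesis by (meson Diff_iff open_contains_ball subsetD)
    next
      case False
      show ?thesis
      proof (cases "x \<in> {a..b}")
        case True
        with False obtain d where "d \<le> 0" "(f has_real_derivative d) (at x)"
          unfolding N_def by force
        then show ?thesis using False derivative_nonpos_straddle[OF _ _ \<open>0 < \<epsilon>\<close>] by metis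
      qed (use False in \<open>auto intro: exI[of _ 1]\<close>)
    qed
    then obtain r where r: "\<And>x. 0 < r x" "\<And>x. x \<in> N \<Longrightarrow> ball x (r x) \<subseteq> U"
      "\<And>x u v. x \<in> {a..b} - N \<Longrightarrow> u \<in> ball x (r x) \<Longrightarrow> v \<in> ball x (r x) \<Longrightarrow> u \<le> x \<Longrightarrow> x \<le> v
         \<Longrightarrow> f v - f u \<le> \<epsilon> * (v - u)"
      by metis
    have "gauge (\<lambda>x. ball x (r x))" using r(1) by (rule gauge_ball_dependent[rule_format])
    then obtain p where p: "p tagged_division_of {a..b}" and fine: "(\<lambda>x. ball x (r x)) fine p"
      by (rule fine_division_exists_real)
    note pD = tagged_division_ofD[OF p]
    have ival: "Inf K \<le> x \<and> x \<le> Sup K \<and> a \<le> Inf K \<and> Sup K \<le> b \<and> {Inf K..Sup K} = K"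
      if xK: "(x, K) \<in> p" for x K
    proof -
      obtain u v where K: "K = {u..v}" using pD(4)[OF xK] by auto
      then have "u \<le> v" using pD(2)[OF xK] by auto
      then show ?thesis using pD(2,3)[OF xK] K by auto
    qed
    \<comment> \<open>A division may contain degenerate intervals, and several of them may coincide under \<open>e\<close>;
      restricting to nondegenerate ones makes \<open>e\<close> injective.\<close>
    define q where "q = {(x, K) \<in> p. x \<in> N \<and> Inf K < Sup K}"
    define e where "e = (\<lambda>(x :: real, K :: real set). (Inf K, Sup K))"
    have disj: "{Inf K<..<Sup K} \<inter> {Inf K'<..<Sup K'} = {}"
      if "(x, K) \<in> p" "(x', K') \<in> p" "(x, K) \<noteq> (x', K')" for x K x' K'
      using pD(5)[OF that] ival[OF that(1)] ival[OF that(2)]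
      by (metis interior_atLeastAtMost_real)
    have inj: "inj_on e q"
    proof (rule inj_onI, clarify)
      fix x K x' K' assume *: "(x, K) \<in> q" "(x', K') \<in> q" "e (x, K) = e (x', K')"
      then have "{Inf K<..<Sup K} \<inter> {Inf K'<..<Sup K'} \<noteq> {}"
        by (auto simp: q_def e_def)
      then show "x = x' \<and> K = K'" using disj[of x K x' K'] * by (auto simp: q_def)
    qed
    have "finite q" using pD(1) by (auto simp: q_def intro: finite_subset)
    have pw: "pairwise (\<lambda>(u, v) (u', v'). {u<..<v} \<inter> {u'<..<v'} = {}) (e ` q)"
      unfolding pairwise_def by (force simp: e_def q_def dest: disj)
    have "(\<Sum>(u, v)\<in>e ` q. v - u) < \<delta>"
    proof -
      have "(\<Sum>(u, v)\<in>e ` q. v - u) = (\<Sum>i\<in>e ` q. measure lebesgue {fst i<..<snd i})"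
        by (rule sum.cong) (auto simp: e_def q_def)
      also have "\<dots> = measure lebesgue (\<Union>i\<in>e ` q. {fst i<..<snd i})"
        using \<open>finite q\<close> pw
        by (intro measure_UNION'[symmetric]) (auto simp: pairwise_def disjnt_def case_prod_beta)
      also have "\<dots> \<le> measure lebesgue U"
      proof (rule measure_mono_fmeasurable)
        show "(\<Union>i\<in>e ` q. {fst i<..<snd i}) \<subseteq> U"
        proof
          fix y assume "y \<in> (\<Union>i\<in>e ` q. {fst i<..<snd i})"
          then obtain x K where xK: "(x, K) \<in> p" "x \<in> N" "y \<in> {Inf K..Sup K}"
            by (auto simp: q_def e_def)
          then have "y \<in> K" using ival[OF xK(1)] by simp
          then show "y \<in> U" using fineD[OF fine xK(1)] r(2)[OF xK(2)] by blast
        qed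
        show "(\<Union>i\<in>e ` q. {fst i<..<snd i}) \<in> sets lebesgue"
          using \<open>finite q\<close> by (intro sets.finite_UN) auto
      qed (use Um in auto)
      also note Um(2)
      finally show ?thesis .
    qed
    then have "(\<Sum>(u, v)\<in>e ` q. norm (f v - f u)) < \<epsilon>"
      using \<open>finite q\<close> pw by (intro D) (auto simp: q_def e_def dest: ival)
    then have q: "(\<Sum>(x, K)\<in>q. norm (f (Sup K) - f (Inf K))) < \<epsilon>"
      by (subst (asm) sum.reindex[OF inj]) (simp add: e_def case_prod_beta)
    have "f b - f a = (\<Sum>(x, K)\<in>p. f (Sup K) - f (Inf K))"
      using additive_tagged_division_1[OF \<open>a \<le> b\<close> p, of f] by simp
    also have "\<dots> \<le> (\<Sum>(x, K)\<in>p. \<epsilon> * (Sup K - Inf K)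
        + (if (x, K) \<in> q then norm (f (Sup K) - f (Inf K)) else 0))"
    proof (rule sum_mono, clarify)
      fix x K assume xK: "(x, K) \<in> p"
      note i = ival[OF xK]
      consider "(x, K) \<in> q" | "Inf K = Sup K" | "x \<notin> N"
        using i xK by (force simp: q_def)
      then show "f (Sup K) - f (Inf K) \<le> \<epsilon> * (Sup K - Inf K)
          + (if (x, K) \<in> q then norm (f (Sup K) - f (Inf K)) else 0)"
      proof cases
        case 1
        then show ?thesis using i \<open>0 < \<epsilon>\<close>
          by (auto intro!: add_increasing)
      next
        case 3
        have "Inf K \<in> K" "Sup K \<in> K" using i by (metis atLeastAtMost_iff order.trans order_refl)+
        then have "Inf K \<in> ball x (r x)" "Sup K \<in> ball x (r x)"
          using fineD[OF fine xK] by auto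
        then have "f (Sup K) - f (Inf K) \<le> \<epsilon> * (Sup K - Inf K)"
          using i 3 by (intro r(3)[of x]) auto
        then show ?thesis by (simp add: add_increasing2)
      qed auto
    qed
    also have "\<dots> = \<epsilon> * (\<Sum>(x, K)\<in>p. Sup K - Inf K)
        + (\<Sum>(x, K)\<in>p. if (x, K) \<in> q then norm (f (Sup K) - f (Inf K)) else 0)"
      by (simp add: sum.distrib sum_distrib_left case_prod_beta)
    also have "(\<Sum>(x, K)\<in>p. Sup K - Inf K) = b - a"
      using additive_tagged_division_1[OF \<open>a \<le> b\<close> p, of "\<lambda>x. x"] by simp
    also have "(\<Sum>(x, K)\<in>p. if (x, K) \<in> q then norm (f (Sup K) - f (Inf K)) else 0)
        = (\<Sum>(x, K)\<in>q. norm (f (Sup K) - f (Inf K)))"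
      using pD(1) by (intro sum.mono_neutral_cong_right) (auto simp: q_def split: if_splits)
    finally show ?thesis using q by simp
  qed
  have "f b - f a \<le> 0"
  proof (rule field_le_epsilon)
    fix \<epsilon> :: real assume "0 < \<epsilon>"
    have "f b - f a \<le> \<epsilon> / (b - a + 1) * (b - a) + \<epsilon> / (b - a + 1)"
      using \<open>0 < \<epsilon>\<close> \<open>a \<le> b\<close> by (intro small) simp
    also have "\<dots> = \<epsilon> / (b - a + 1) * (b - a + 1)" by (simp add: distrib_left)
    also have "\<dots> = \<epsilon>" using \<open>a \<le> b\<close> by simp
    finally show "f b - f a \<le> 0 + \<epsilon>" by simp
  qed
  then show ?thesis by simp
qed

lemma abs_continuous_increment_le:
  fixes f :: "real \<Rightarrow> real"
  assumes ac: "abs_continuous_on_interval a b f" and "a \<le> b"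
    and ae: "AE x in lebesgue. x \<in> {a<..<b} \<longrightarrow> (\<exists>d\<le>c. (f has_real_derivative d) (at x))"
  shows "f b - f a \<le> c * (b - a)"
proof -
  have "f b + (- c * b + 0) \<le> f a + (- c * a + 0)"
  proof (rule abs_continuous_derivative_nonpos[OF _ \<open>a \<le> b\<close>])
    show "abs_continuous_on_interval a b (\<lambda>t. f t + (- c * t + 0))"
      by (intro abs_continuous_on_interval_add abs_continuous_on_interval_affine
          abs_continuous_on_interval_id ac)
    show "AE x in lebesgue. x \<in> {a<..<b} \<longrightarrow>
        (\<exists>d\<le>0. ((\<lambda>t. f t + (- c * t + 0)) has_real_derivative d) (at x))"
      using ae
    proof eventually_elim
      case (elim x)
      show ?case
      proof
        assume "x \<in> {a<..<b}"
        with elim obtain d where "d \<le> c" "(f has_real_derivative d) (at x)" by blast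
        then show "\<exists>d\<le>0. ((\<lambda>t. f t + (- c * t + 0)) has_real_derivative d) (at x)"
          by (intro exI[of _ "d - c"]) (auto intro!: derivative_eq_intros)
      qed
    qed
  qed
  then show ?thesis by (simp add: algebra_simps)
qed

lemma abs_continuous_lipschitz:
  fixes f :: "real \<Rightarrow> real"
  assumes ac: "\<And>T. 0 \<le> T \<Longrightarrow> abs_continuous_on_interval 0 T f" and "0 \<le> c"
    and ae: "AE x in lebesgue. 0 < x \<longrightarrow> (\<exists>d. \<bar>d\<bar> \<le> c \<and> (f has_real_derivative d) (at x))"
  shows "c-lipschitz_on {0..} f"
proof (rule lipschitz_on_leI)
  fix s t :: real assume st: "s \<in> {0..}" "t \<in> {0..}" "s \<le> t"
  have ac': "abs_continuous_on_interval s t f"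
    using st by (intro abs_continuous_on_interval_subset[OF ac[of t]]) auto
  have "f t - f s \<le> c * (t - s)"
  proof (rule abs_continuous_increment_le[OF ac' \<open>s \<le> t\<close>])
    show "AE x in lebesgue. x \<in> {s<..<t} \<longrightarrow> (\<exists>d\<le>c. (f has_real_derivative d) (at x))"
      using ae by eventually_elim (use st in \<open>auto simp: abs_le_iff\<close>)
  qed
  moreover have "- 1 * f t + 0 - (- 1 * f s + 0) \<le> c * (t - s)"
  proof (rule abs_continuous_increment_le[OF abs_continuous_on_interval_affine[OF ac'] \<open>s \<le> t\<close>])
    show "AE x in lebesgue. x \<in> {s<..<t} \<longrightarrow>
        (\<exists>d\<le>c. ((\<lambda>t. - 1 * f t + 0) has_real_derivative d) (at x))"
      using ae
    proof eventually_elim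
      case (elim x)
      show ?case
      proof
        assume "x \<in> {s<..<t}"
        with elim st obtain d where "\<bar>d\<bar> \<le> c" "(f has_real_derivative d) (at x)" by auto
        then show "\<exists>d\<le>c. ((\<lambda>t. - 1 * f t + 0) has_real_derivative d) (at x)"
          by (intro exI[of _ "- d"]) (auto intro!: derivative_eq_intros)
      qed
    qed
  qed
  ultimately show "dist (f s) (f t) \<le> c * dist s t"
    using \<open>s \<le> t\<close> by (simp add: dist_real_def abs_le_iff)
qed (rule \<open>0 \<le> c\<close>)

section \<open>A Barbalat argument\<close>

text \<open>If \<open>y t \<ge> \<epsilon>\<close>, then \<open>y \<ge> \<epsilon> / 2\<close> on an interval \<open>[t, t + h]\<close> whose length depends only on \<open>\<epsilon>\<close> and
  the Lipschitz constant, so \<open>w\<close> drops there by at least \<open>h * \<epsilon> / 2\<close>. For large \<open>t\<close> this contradicts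
  the convergence of \<open>w\<close>. The one-sided form serves both the energy, for which only an upper bound
  of the derivative is known, and the two-sided statement below.\<close>

lemma eventually_dissipation_less:
  fixes w y :: "real \<Rightarrow> real"
  assumes ac: "\<And>T. 0 \<le> T \<Longrightarrow> abs_continuous_on_interval 0 T w"
    and lim: "(w \<longlongrightarrow> l) at_top"
    and ae: "AE x in lebesgue. 0 < x \<longrightarrow> (\<exists>d\<le>- y x. (w has_real_derivative d) (at x))"
    and lip: "L-lipschitz_on {0..} y" and "0 < \<epsilon>"
  shows "\<forall>\<^sub>F t in at_top. y t < \<epsilon>"
proof -
  \<comment> \<open>\<open>L + 1\<close> in place of \<open>L\<close> because the Lipschitz constant may be zero.\<close>
  define h where "h = \<epsilon> / (2 * (L + 1))"
  have "0 \<le> L" using lip by (rule lipschitz_on_nonneg)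
  then have h: "0 < h" "L * h \<le> \<epsilon> / 2"
    using \<open>0 < \<epsilon>\<close> by (auto simp: h_def field_simps)
  have "0 < h * \<epsilon> / 4" using h \<open>0 < \<epsilon>\<close> by simp
  then have "\<forall>\<^sub>F t in at_top. dist (w t) l < h * \<epsilon> / 4" by (rule tendstoD[OF lim])
  then obtain T where T: "\<And>t. T \<le> t \<Longrightarrow> \<bar>w t - l\<bar> < h * \<epsilon> / 4"
    by (auto simp: eventually_at_top_linorder dist_real_def)
  have "y t < \<epsilon>" if "max T 0 \<le> t" for t
  proof (rule ccontr)
    assume "\<not> y t < \<epsilon>"
    have low: "\<epsilon> / 2 \<le> y s" if "s \<in> {t<..<t + h}" for s
    proof -
      have "\<bar>y t - y s\<bar> \<le> L * \<bar>t - s\<bar>"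
        using lipschitz_on_normD[OF lip, of t s] \<open>max T 0 \<le> t\<close> that by simp
      also have "\<dots> \<le> L * h" using that \<open>0 \<le> L\<close> by (intro mult_left_mono) auto
      finally show ?thesis using h(2) \<open>\<not> y t < \<epsilon>\<close> by linarith
    qed
    have "w (t + h) - w t \<le> - (\<epsilon> / 2) * (t + h - t)"
    proof (rule abs_continuous_increment_le)
      show "abs_continuous_on_interval t (t + h) w"
        using \<open>max T 0 \<le> t\<close> h(1) by (intro abs_continuous_on_interval_subset[OF ac[of "t + h"]]) auto
      show "AE x in lebesgue. x \<in> {t<..<t + h} \<longrightarrow>
          (\<exists>d\<le>- (\<epsilon> / 2). (w has_real_derivative d) (at x))"
        using ae
      proof eventually_elim
        case (elim x)
        show ?case
        proof
          assume x: "x \<in> {t<..<t + h}"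
          with elim \<open>max T 0 \<le> t\<close> obtain d where "d \<le> - y x" "(w has_real_derivative d) (at x)"
            by auto
          with low[OF x] show "\<exists>d\<le>- (\<epsilon> / 2). (w has_real_derivative d) (at x)"
            by (intro exI[of _ d]) auto
        qed
      qed
    qed (use h in simp)
    moreover have "\<bar>w t - l\<bar> < h * \<epsilon> / 4" "\<bar>w (t + h) - l\<bar> < h * \<epsilon> / 4"
      using T[of t] T[of "t + h"] \<open>max T 0 \<le> t\<close> h by auto
    ultimately show False unfolding abs_less_iff by (simp add: field_simps)
  qed
  then show ?thesis unfolding eventually_at_top_linorder by blast
qed

lemma nonneg_dissipation_tendsto_zero:
  fixes w y :: "real \<Rightarrow> real"
  assumes "\<And>T. 0 \<le> T \<Longrightarrow> abs_continuous_on_interval 0 T w" "(w \<longlongrightarrow> l) at_top"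
    and "AE x in lebesgue. 0 < x \<longrightarrow> (\<exists>d\<le>- y x. (w has_real_derivative d) (at x))"
    and "L-lipschitz_on {0..} y" and nonneg: "\<And>t. 0 \<le> t \<Longrightarrow> 0 \<le> y t"
  shows "(y \<longlongrightarrow> 0) at_top"
proof (rule tendstoI)
  fix \<epsilon> :: real assume "0 < \<epsilon>"
  with assms have "\<forall>\<^sub>F t in at_top. y t < \<epsilon>" by (intro eventually_dissipation_less)
  then show "\<forall>\<^sub>F t in at_top. dist (y t) 0 < \<epsilon>"
    using eventually_ge_at_top[of 0] by eventually_elim (use nonneg in simp)
qed

lemma barbalat_abs_continuous:
  fixes w y :: "real \<Rightarrow> real"
  assumes ac: "\<And>T. 0 \<le> T \<Longrightarrow> abs_continuous_on_interval 0 T w"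
    and lim: "(w \<longlongrightarrow> l) at_top"
    and ae: "AE x in lebesgue. 0 < x \<longrightarrow> (w has_real_derivative y x) (at x)"
    and lip: "L-lipschitz_on {0..} y"
  shows "(y \<longlongrightarrow> 0) at_top"
proof (rule tendstoI)
  fix \<epsilon> :: real assume "0 < \<epsilon>"
  have "\<forall>\<^sub>F t in at_top. - y t < \<epsilon>"
  proof (rule eventually_dissipation_less[OF ac lim])
    show "AE x in lebesgue. 0 < x \<longrightarrow> (\<exists>d\<le>- (- y x). (w has_real_derivative d) (at x))"
      using ae by eventually_elim auto
  qed (use lip \<open>0 < \<epsilon>\<close> in auto)
  moreover have "\<forall>\<^sub>F t in at_top. y t < \<epsilon>"
  proof (rule eventually_dissipation_less)
    show "abs_continuous_on_interval 0 T (\<lambda>t. - 1 * w t + 0)" if "0 \<le> T" for T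
      using ac[OF that] by (rule abs_continuous_on_interval_affine)
    show "((\<lambda>t. - 1 * w t + 0) \<longlongrightarrow> - 1 * l + 0) at_top" by (intro tendsto_intros lim)
    show "AE x in lebesgue. 0 < x \<longrightarrow>
        (\<exists>d\<le>- y x. ((\<lambda>t. - 1 * w t + 0) has_real_derivative d) (at x))"
      using ae by eventually_elim (auto intro!: derivative_eq_intros exI[of _ "- y _"])
  qed (use lip \<open>0 < \<epsilon>\<close> in auto)
  ultimately show "\<forall>\<^sub>F t in at_top. dist (y t) 0 < \<epsilon>"
    by eventually_elim (simp add: abs_less_iff)
qed

lemma decreasing_nonneg_convergent:
  fixes f :: "real \<Rightarrow> real"
  assumes dec: "\<And>s t. 0 \<le> s \<Longrightarrow> s \<le> t \<Longrightarrow> f t \<le> f s" and nonneg: "\<And>t. 0 \<le> t \<Longrightarrow> 0 \<le> f t"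
  obtains l where "(f \<longlongrightarrow> l) at_top"
proof -
  have bdd: "bdd_below (f ` {0..})" using nonneg by (auto intro: bdd_belowI[of _ 0])
  have "(f \<longlongrightarrow> (INF t\<in>{0..}. f t)) at_top"
  proof (rule decreasing_tendsto)
    show "\<forall>\<^sub>F t in at_top. (INF t\<in>{0..}. f t) \<le> f t"
      using eventually_ge_at_top[of 0] by eventually_elim (auto intro: cINF_lower[OF bdd])
    fix x assume "(INF t\<in>{0..}. f t) < x"
    then obtain s where "0 \<le> s" "f s < x" using bdd by (auto simp: cINF_less_iff)
    with dec have "f t < x" if "s \<le> t" for t using that by (meson le_less_trans)
    then show "\<forall>\<^sub>F t in at_top. f t < x" unfolding eventually_at_top_linorder by blast
  qed
  then show thesis by (rule that)
qed

section \<open>Constraint forces\<close>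

lemma normal_coneD: "w \<in> normal_cone S z \<Longrightarrow> y \<in> S \<Longrightarrow> 0 \<le> w * (z - y)"
  by (auto simp: normal_cone_def split: if_splits)

text \<open>The trajectory stays in \<open>S\<close> both before and after \<open>t\<close>, so \<open>\<nu> * x s\<close> has a local maximum at
  \<open>s = t\<close>. The hypothesis \<open>0 < t\<close> provides the times before \<open>t\<close>.\<close>

lemma normal_cone_orthogonal_velocity:
  assumes deriv: "(x has_real_derivative d) (at t)" and "\<nu> \<in> normal_cone S (x t)"
    and "0 < t" and S: "\<And>s. 0 \<le> s \<Longrightarrow> x s \<in> S"
  shows "\<nu> * d = 0"
proof (rule DERIV_local_max[where d = t])
  show "((\<lambda>s. \<nu> * x s) has_real_derivative \<nu> * d) (at t)"
    using deriv by (rule DERIV_cmult)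
  show "\<forall>s. \<bar>t - s\<bar> < t \<longrightarrow> \<nu> * x s \<le> \<nu> * x t"
    using normal_coneD[OF assms(2) S] by (auto simp: right_diff_distrib)
qed (rule \<open>0 < t\<close>)

section \<open>Convergence of the closed loop\<close>

lemma product4_has_real_derivatives:
  fixes f\<^sub>1 f\<^sub>2 f\<^sub>3 f\<^sub>4 :: "real \<Rightarrow> real"
  assumes "((\<lambda>t. (f\<^sub>1 t, f\<^sub>2 t, f\<^sub>3 t, f\<^sub>4 t)) has_vector_derivative (d\<^sub>1, d\<^sub>2, d\<^sub>3, d\<^sub>4)) F"
  shows "(f\<^sub>1 has_real_derivative d\<^sub>1) F" "(f\<^sub>2 has_real_derivative d\<^sub>2) F"
    "(f\<^sub>3 has_real_derivative d\<^sub>3) F" "(f\<^sub>4 has_real_derivative d\<^sub>4) F"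
proof -
  note fst = bounded_linear.has_vector_derivative[OF bounded_linear_fst]
  note snd = bounded_linear.has_vector_derivative[OF bounded_linear_snd]
  show "(f\<^sub>1 has_real_derivative d\<^sub>1) F" "(f\<^sub>2 has_real_derivative d\<^sub>2) F"
    "(f\<^sub>3 has_real_derivative d\<^sub>3) F" "(f\<^sub>4 has_real_derivative d\<^sub>4) F"
    using fst[OF assms] fst[OF snd[OF assms]] fst[OF snd[OF snd[OF assms]]]
      snd[OF snd[OF snd[OF assms]]]
    by (simp_all add: has_real_derivative_iff_has_vector_derivative)
qed

lemma abs_continuous_on_interval_product4:
  fixes f\<^sub>1 f\<^sub>2 f\<^sub>3 f\<^sub>4 :: "real \<Rightarrow> real"
  assumes "abs_continuous_on_interval a b (\<lambda>t. (f\<^sub>1 t, f\<^sub>2 t, f\<^sub>3 t, f\<^sub>4 t))"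
  shows "abs_continuous_on_interval a b f\<^sub>1" "abs_continuous_on_interval a b f\<^sub>2"
    "abs_continuous_on_interval a b f\<^sub>3" "abs_continuous_on_interval a b f\<^sub>4"
proof -
  have fst: "abs_continuous_on_interval a b (\<lambda>t. fst (f t))"
    if "abs_continuous_on_interval a b f" for f :: "real \<Rightarrow> 'x::real_normed_vector \<times> 'y::real_normed_vector"
    using that by (rule abs_continuous_on_interval_lipschitz_comp)
      (auto intro!: lipschitz_onI[where L = 1] simp: dist_fst_le)
  have snd: "abs_continuous_on_interval a b (\<lambda>t. snd (f t))"
    if "abs_continuous_on_interval a b f" for f :: "real \<Rightarrow> 'x::real_normed_vector \<times> 'y::real_normed_vector"
    using that by (rule abs_continuous_on_interval_lipschitz_comp)
      (auto intro!: lipschitz_onI[where L = 1] simp: dist_snd_le)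
  show "abs_continuous_on_interval a b f\<^sub>1" "abs_continuous_on_interval a b f\<^sub>2"
    "abs_continuous_on_interval a b f\<^sub>3" "abs_continuous_on_interval a b f\<^sub>4"
    using fst[OF assms] fst[OF snd[OF assms]] fst[OF snd[OF snd[OF assms]]]
      snd[OF snd[OF snd[OF assms]]] by simp_all
qed

theorem propositionV1:
  fixes C L\<^sub>1 L\<^sub>2 R I\<^sub>m\<^sub>i\<^sub>n I\<^sub>m\<^sub>a\<^sub>x V\<^sub>r\<^sub>e\<^sub>f :: real
    and K :: "real set"
    and v0 i10 i20 i0 :: real
    and V\<^sub>C I\<^sub>1 I\<^sub>2 I :: "real \<Rightarrow> real"
  assumes "C > 0" and "L\<^sub>1 > 0" and "L\<^sub>2 > 0" and "R > 0"
    and "0 < I\<^sub>m\<^sub>i\<^sub>n" and "I\<^sub>m\<^sub>i\<^sub>n < I\<^sub>m\<^sub>a\<^sub>x"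
    and "K = {I\<^sub>m\<^sub>i\<^sub>n..I\<^sub>m\<^sub>a\<^sub>x}"
    and "V\<^sub>r\<^sub>e\<^sub>f \<in> {R * I\<^sub>m\<^sub>i\<^sub>n..R * I\<^sub>m\<^sub>a\<^sub>x}"
    and "(v0, i10, i20, i0) \<in> UNIV \<times> UNIV \<times> {0..} \<times> K"
    and "strong_solution (closed_loop C L\<^sub>1 L\<^sub>2 R K V\<^sub>r\<^sub>e\<^sub>f) (UNIV \<times> UNIV \<times> {0..} \<times> K)
           (v0, i10, i20, i0) (\<lambda>t. (V\<^sub>C t, I\<^sub>1 t, I\<^sub>2 t, I t))"
  shows "((\<lambda>t. (V\<^sub>C t, I\<^sub>1 t, I\<^sub>2 t, I t)) \<longlongrightarrow>
            (V\<^sub>r\<^sub>e\<^sub>f, (1 / R) * V\<^sub>r\<^sub>e\<^sub>f, 0, (1 / R) * V\<^sub>r\<^sub>e\<^sub>f)) at_top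
         \<and> (\<forall>t\<ge>0. I t \<in> {I\<^sub>m\<^sub>i\<^sub>n..I\<^sub>m\<^sub>a\<^sub>x})"
proof -
  have [simp]: "C \<noteq> 0" "L\<^sub>1 \<noteq> 0" "L\<^sub>2 \<noteq> 0" "R \<noteq> 0"
    "0 \<le> C" "0 \<le> L\<^sub>1" "0 \<le> L\<^sub>2" "0 \<le> R"
    using \<open>C > 0\<close> \<open>L\<^sub>1 > 0\<close> \<open>L\<^sub>2 > 0\<close> \<open>R > 0\<close> by auto
  note [simp] = \<open>C > 0\<close> \<open>L\<^sub>1 > 0\<close> \<open>L\<^sub>2 > 0\<close> \<open>R > 0\<close>
  note sol = \<open>strong_solution _ _ _ _\<close>[unfolded strong_solution_def]
  have I2_nonneg: "0 \<le> I\<^sub>2 t" and I_in_K: "I t \<in> K" if "0 \<le> t" for t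
    using sol that by auto
  define i where "i = (1 / R) * V\<^sub>r\<^sub>e\<^sub>f"
  have Vref: "V\<^sub>r\<^sub>e\<^sub>f = R * i" by (simp add: i_def)
  have "i \<in> K" using \<open>V\<^sub>r\<^sub>e\<^sub>f \<in> _\<close> \<open>K = _\<close> by (simp add: Vref)
  then have "0 < i" using \<open>0 < I\<^sub>m\<^sub>i\<^sub>n\<close> \<open>K = _\<close> by auto

  have ac: "abs_continuous_on_interval 0 T V\<^sub>C" "abs_continuous_on_interval 0 T I\<^sub>1"
    "abs_continuous_on_interval 0 T I\<^sub>2" "abs_continuous_on_interval 0 T I" if "0 \<le> T" for T
    using sol that abs_continuous_on_interval_product4[of 0 T V\<^sub>C I\<^sub>1 I\<^sub>2 I] by blast+

  \<comment> \<open>The data available at almost every time: the equations with multipliers \<open>\<nu>\<close> and \<open>\<mu>\<close>, the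
    alternative that a multiplier vanishes or the constrained velocity does, and the two signs that
    make the multipliers dissipative.\<close>
  define regular where "regular = (\<lambda>t \<nu> \<mu>.
    (V\<^sub>C has_real_derivative (I t - I\<^sub>1 t) / C) (at t) \<and>
    (I\<^sub>1 has_real_derivative (V\<^sub>C t - R * (I\<^sub>1 t + I\<^sub>2 t)) / L\<^sub>1) (at t) \<and>
    (I\<^sub>2 has_real_derivative - (R * (I\<^sub>1 t + I\<^sub>2 t) + \<nu>) / L\<^sub>2) (at t) \<and>
    (I has_real_derivative V\<^sub>r\<^sub>e\<^sub>f - V\<^sub>C t - \<mu>) (at t) \<and>
    (\<nu> = 0 \<or> R * (I\<^sub>1 t + I\<^sub>2 t) + \<nu> = 0) \<and> (\<mu> = 0 \<or> V\<^sub>r\<^sub>e\<^sub>f - V\<^sub>C t - \<mu> = 0) \<and>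
    0 \<le> \<nu> * I\<^sub>2 t \<and> 0 \<le> \<mu> * (I t - i))"
  have regular: "AE t in lebesgue. 0 < t \<longrightarrow> (\<exists>\<nu> \<mu>. regular t \<nu> \<mu>)"
    using sol[THEN conjunct2, THEN conjunct2, THEN conjunct2]
  proof eventually_elim
    case (elim t)
    show ?case
    proof
      assume "0 < t"
      with elim obtain d where
        d: "((\<lambda>t. (V\<^sub>C t, I\<^sub>1 t, I\<^sub>2 t, I t)) has_vector_derivative d) (at t within {0..})"
        and dF: "d \<in> closed_loop C L\<^sub>1 L\<^sub>2 R K V\<^sub>r\<^sub>e\<^sub>f (V\<^sub>C t, I\<^sub>1 t, I\<^sub>2 t, I t)"
        by auto
      from dF obtain \<nu> \<mu> where \<nu>: "\<nu> \<in> normal_cone {0..} (I\<^sub>2 t)" and \<mu>: "\<mu> \<in> normal_cone K (I t)"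
        and d_raw: "d = (- (1 / C) * I\<^sub>1 t + (1 / C) * I t,
          (1 / L\<^sub>1) * V\<^sub>C t - (R / L\<^sub>1) * (I\<^sub>1 t + I\<^sub>2 t),
          - (R / L\<^sub>2) * (I\<^sub>1 t + I\<^sub>2 t) - (1 / L\<^sub>2) * \<nu>, - \<mu> + V\<^sub>r\<^sub>e\<^sub>f - V\<^sub>C t)"
        unfolding closed_loop_def by blast
      have d_eq: "d = ((I t - I\<^sub>1 t) / C, (V\<^sub>C t - R * (I\<^sub>1 t + I\<^sub>2 t)) / L\<^sub>1,
          - (R * (I\<^sub>1 t + I\<^sub>2 t) + \<nu>) / L\<^sub>2, V\<^sub>r\<^sub>e\<^sub>f - V\<^sub>C t - \<mu>)"
        unfolding d_raw by (simp add: diff_divide_distrib add_divide_distrib)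
      have "at t within {0..} = at t"
        using \<open>0 < t\<close> by (intro at_within_interior) simp
      note derivs = product4_has_real_derivatives[OF d[unfolded this d_eq]]
      have "\<nu> * (- (R * (I\<^sub>1 t + I\<^sub>2 t) + \<nu>) / L\<^sub>2) = 0"
        using normal_cone_orthogonal_velocity[OF derivs(3) \<nu> \<open>0 < t\<close>] I2_nonneg by auto
      then have \<nu>': "\<nu> = 0 \<or> R * (I\<^sub>1 t + I\<^sub>2 t) + \<nu> = 0"
        by (simp only: mult_eq_0_iff divide_eq_0_iff neg_equal_0_iff_equal) auto
      have "\<mu> * (V\<^sub>r\<^sub>e\<^sub>f - V\<^sub>C t - \<mu>) = 0"
        using normal_cone_orthogonal_velocity[OF derivs(4) \<mu> \<open>0 < t\<close>] I_in_K by auto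
      then have \<mu>': "\<mu> = 0 \<or> V\<^sub>r\<^sub>e\<^sub>f - V\<^sub>C t - \<mu> = 0"
        by (simp only: mult_eq_0_iff)
      have sign: "0 \<le> \<nu> * I\<^sub>2 t" "0 \<le> \<mu> * (I t - i)"
        using normal_coneD[OF \<nu>, of 0] normal_coneD[OF \<mu> \<open>i \<in> K\<close>] by simp_all
      have "regular t \<nu> \<mu>"
        unfolding regular_def by (intro conjI derivs \<nu>' \<mu>' sign)
      then show "\<exists>\<nu> \<mu>. regular t \<nu> \<mu>" by blast
    qed
  qed

  \<comment> \<open>The factors \<open>1\<close> and summands \<open>0\<close> give every term the affine shape \<open>c * f t + k\<close> in which
    the closure rules for absolute continuity apply.\<close>
  define E where "E = (\<lambda>t. (C / 2 * (1 * V\<^sub>C t + - V\<^sub>r\<^sub>e\<^sub>f)\<^sup>2 + 0) + (L\<^sub>1 / 2 * (1 * I\<^sub>1 t + - i)\<^sup>2 + 0)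
    + (L\<^sub>2 / 2 * (I\<^sub>2 t)\<^sup>2 + 0) + (1 / 2 * (1 * I t + - i)\<^sup>2 + 0))"
  have acE: "abs_continuous_on_interval 0 T E" if "0 \<le> T" for T
    unfolding E_def
    by (intro abs_continuous_on_interval_add abs_continuous_on_interval_affine
        abs_continuous_on_interval_power2 ac that)
  have dE: "(E has_real_derivative C * (V\<^sub>C t - V\<^sub>r\<^sub>e\<^sub>f) * v' + L\<^sub>1 * (I\<^sub>1 t - i) * i\<^sub>1'
      + L\<^sub>2 * I\<^sub>2 t * i\<^sub>2' + (I t - i) * i') (at t)"
    if "(V\<^sub>C has_real_derivative v') (at t)" "(I\<^sub>1 has_real_derivative i\<^sub>1') (at t)"
      "(I\<^sub>2 has_real_derivative i\<^sub>2') (at t)" "(I has_real_derivative i') (at t)" for t v' i\<^sub>1' i\<^sub>2' i'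
    unfolding E_def by (rule derivative_eq_intros refl that)+ simp
  have dissipation: "AE t in lebesgue. 0 < t \<longrightarrow>
      (\<exists>d. (E has_real_derivative d) (at t) \<and> d \<le> - (R * (I\<^sub>1 t - i + I\<^sub>2 t)\<^sup>2) - V\<^sub>r\<^sub>e\<^sub>f * I\<^sub>2 t)"
    using regular
  proof eventually_elim
    case (elim t)
    show ?case
    proof
      assume "0 < t"
      with elim obtain \<nu> \<mu> where reg: "regular t \<nu> \<mu>" by blast
      define d where "d = C * (V\<^sub>C t - V\<^sub>r\<^sub>e\<^sub>f) * ((I t - I\<^sub>1 t) / C)
        + L\<^sub>1 * (I\<^sub>1 t - i) * ((V\<^sub>C t - R * (I\<^sub>1 t + I\<^sub>2 t)) / L\<^sub>1)
        + L\<^sub>2 * I\<^sub>2 t * (- (R * (I\<^sub>1 t + I\<^sub>2 t) + \<nu>) / L\<^sub>2) + (I t - i) * (V\<^sub>r\<^sub>e\<^sub>f - V\<^sub>C t - \<mu>)"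
      have "(E has_real_derivative d) (at t)"
        unfolding d_def by (rule dE) (use reg in \<open>auto simp only: regular_def\<close>)
      moreover have "d = - (R * (I\<^sub>1 t - i + I\<^sub>2 t)\<^sup>2) - V\<^sub>r\<^sub>e\<^sub>f * I\<^sub>2 t - \<nu> * I\<^sub>2 t - \<mu> * (I t - i)"
      proof -
        have "d = (V\<^sub>C t - V\<^sub>r\<^sub>e\<^sub>f) * (I t - I\<^sub>1 t) + (I\<^sub>1 t - i) * (V\<^sub>C t - R * (I\<^sub>1 t + I\<^sub>2 t))
            - I\<^sub>2 t * (R * (I\<^sub>1 t + I\<^sub>2 t) + \<nu>) + (I t - i) * (V\<^sub>r\<^sub>e\<^sub>f - V\<^sub>C t - \<mu>)"
          by (simp add: d_def, simp add: algebra_simps)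
        \<comment> \<open>The products coupling \<open>V\<^sub>C\<close> with \<open>I\<^sub>1\<close> and with \<open>I\<close> cancel.\<close>
        then show ?thesis unfolding Vref by algebra
      qed
      ultimately show "\<exists>d. (E has_real_derivative d) (at t) \<and>
          d \<le> - (R * (I\<^sub>1 t - i + I\<^sub>2 t)\<^sup>2) - V\<^sub>r\<^sub>e\<^sub>f * I\<^sub>2 t"
        using reg by (intro exI[of _ d]) (auto simp: regular_def)
    qed
  qed
  have dissipation_le: "AE t in lebesgue. 0 < t \<longrightarrow> (\<exists>d\<le>c t. (E has_real_derivative d) (at t))"
    if "\<And>t. 0 < t \<Longrightarrow> - (R * (I\<^sub>1 t - i + I\<^sub>2 t)\<^sup>2) - V\<^sub>r\<^sub>e\<^sub>f * I\<^sub>2 t \<le> c t" for c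
    using dissipation by eventually_elim (use that order.trans in blast)
  have load_nonneg: "0 \<le> R * (I\<^sub>1 t - i + I\<^sub>2 t)\<^sup>2" for t
    by (intro mult_nonneg_nonneg) simp_all
  have source_nonneg: "0 \<le> V\<^sub>r\<^sub>e\<^sub>f * I\<^sub>2 t" if "0 \<le> t" for t
    unfolding Vref using I2_nonneg[OF that] \<open>0 < i\<close> by (intro mult_nonneg_nonneg) simp_all
  have E_mono: "E t \<le> E s" if "0 \<le> s" "s \<le> t" for s t
  proof (rule abs_continuous_derivative_nonpos[OF _ \<open>s \<le> t\<close>])
    show "abs_continuous_on_interval s t E"
      using that by (intro abs_continuous_on_interval_subset[OF acE[of t]]) auto
    have "AE x in lebesgue. 0 < x \<longrightarrow> (\<exists>d\<le>0. (E has_real_derivative d) (at x))"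
      using load_nonneg source_nonneg by (intro dissipation_le) (smt (verit))
    then show "AE x in lebesgue. x \<in> {s<..<t} \<longrightarrow> (\<exists>d\<le>0. (E has_real_derivative d) (at x))"
      by eventually_elim (use \<open>0 \<le> s\<close> in auto)
  qed
  have E_nonneg: "0 \<le> E t" for t by (simp add: E_def)
  obtain e where E_lim: "(E \<longlongrightarrow> e) at_top"
    by (rule decreasing_nonneg_convergent[OF E_mono E_nonneg])

  \<comment> \<open>Each weighted square is at most \<open>E t \<le> E 0\<close>, and \<open>\<bar>x\<bar> \<le> 1 + x\<^sup>2\<close>.\<close>
  define M where "M = 1 + 2 * E 0 / C + 2 * E 0 / L\<^sub>1 + 2 * E 0 / L\<^sub>2 + 2 * E 0"
  have M_terms: "0 \<le> 2 * E 0 / C" "0 \<le> 2 * E 0 / L\<^sub>1" "0 \<le> 2 * E 0 / L\<^sub>2" "0 \<le> 2 * E 0"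
    using E_nonneg[of 0] by simp_all
  then have "0 < M" unfolding M_def by linarith
  have bound: "\<bar>V\<^sub>C t - V\<^sub>r\<^sub>e\<^sub>f\<bar> \<le> M" "\<bar>I\<^sub>1 t - i\<bar> \<le> M" "\<bar>I\<^sub>2 t\<bar> \<le> M" "\<bar>I t - i\<bar> \<le> M"
    if "0 \<le> t" for t
  proof -
    have *: "\<bar>x\<bar> \<le> M" if "c / 2 * x\<^sup>2 \<le> E t" "c \<in> {C, L\<^sub>1, L\<^sub>2, 1}" for c x
    proof -
      have "0 < c" using that(2) by auto
      have "\<bar>x\<bar> \<le> 1 + x\<^sup>2"
        using zero_le_power2[of "\<bar>x\<bar> - 1"] by (simp add: power2_diff)
      also have "x\<^sup>2 \<le> 2 * E 0 / c"
        using that(1) E_mono[of 0 t] \<open>0 \<le> t\<close> \<open>0 < c\<close> by (simp add: field_simps)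
      also have "1 + 2 * E 0 / c \<le> M"
        using that(2) M_terms unfolding M_def by (elim insertE emptyE; simp)
      finally show ?thesis by simp
    qed
    show "\<bar>V\<^sub>C t - V\<^sub>r\<^sub>e\<^sub>f\<bar> \<le> M" "\<bar>I\<^sub>1 t - i\<bar> \<le> M" "\<bar>I\<^sub>2 t\<bar> \<le> M" "\<bar>I t - i\<bar> \<le> M"
      by (rule *[of C] *[of L\<^sub>1] *[of L\<^sub>2] *[of 1]; simp add: E_def)+
  qed

  have lipV: "(2 * M / C)-lipschitz_on {0..} V\<^sub>C"
  proof (rule abs_continuous_lipschitz[OF ac(1)])
    show "AE x in lebesgue. 0 < x \<longrightarrow> (\<exists>d. \<bar>d\<bar> \<le> 2 * M / C \<and> (V\<^sub>C has_real_derivative d) (at x))"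
      using regular
    proof eventually_elim
      case (elim t)
      have "\<bar>(I t - I\<^sub>1 t) / C\<bar> \<le> 2 * M / C" if "0 < t"
        using bound(2,4)[of t] that by (auto simp: abs_divide intro!: divide_right_mono)
      with elim show ?case unfolding regular_def by blast
    qed
  qed (use \<open>0 < M\<close> in auto)
  have lip1: "((M + R * (2 * M)) / L\<^sub>1)-lipschitz_on {0..} I\<^sub>1"
  proof (rule abs_continuous_lipschitz[OF ac(2)])
    show "AE x in lebesgue. 0 < x \<longrightarrow>
        (\<exists>d. \<bar>d\<bar> \<le> (M + R * (2 * M)) / L\<^sub>1 \<and> (I\<^sub>1 has_real_derivative d) (at x))"
      using regular
    proof eventually_elim
      case (elim t)
      have "\<bar>(V\<^sub>C t - R * (I\<^sub>1 t + I\<^sub>2 t)) / L\<^sub>1\<bar> \<le> (M + R * (2 * M)) / L\<^sub>1" if "0 < t"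
      proof -
        have "V\<^sub>C t - R * (I\<^sub>1 t + I\<^sub>2 t) = (V\<^sub>C t - V\<^sub>r\<^sub>e\<^sub>f) - R * (I\<^sub>1 t - i + I\<^sub>2 t)"
          by (simp add: Vref algebra_simps)
        moreover have "\<bar>R * (I\<^sub>1 t - i + I\<^sub>2 t)\<bar> \<le> R * (2 * M)"
          using bound(2,3)[of t] that by (auto simp: abs_mult intro!: mult_left_mono)
        ultimately show ?thesis
          using bound(1)[of t] that by (auto simp: abs_divide intro!: divide_right_mono)
      qed
      with elim show ?case unfolding regular_def by blast
    qed
  qed (use \<open>0 < M\<close> in \<open>auto intro!: divide_nonneg_pos add_nonneg_nonneg\<close>)
  have lip2: "((R * (2 * M + i)) / L\<^sub>2)-lipschitz_on {0..} I\<^sub>2"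
  proof (rule abs_continuous_lipschitz[OF ac(3)])
    show "AE x in lebesgue. 0 < x \<longrightarrow>
        (\<exists>d. \<bar>d\<bar> \<le> (R * (2 * M + i)) / L\<^sub>2 \<and> (I\<^sub>2 has_real_derivative d) (at x))"
      using regular
    proof eventually_elim
      case (elim t)
      show ?case
      proof
        assume "0 < t"
        with elim obtain \<nu> \<mu> where "regular t \<nu> \<mu>" by blast
        note reg = this[unfolded regular_def]
        define d where "d = - (R * (I\<^sub>1 t + I\<^sub>2 t) + \<nu>) / L\<^sub>2"
        have "d = 0 \<or> d = - (R * (I\<^sub>1 t + I\<^sub>2 t)) / L\<^sub>2"
          using reg unfolding d_def by auto
        moreover have "\<bar>- (R * (I\<^sub>1 t + I\<^sub>2 t)) / L\<^sub>2\<bar> \<le> (R * (2 * M + i)) / L\<^sub>2"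
        proof -
          have "\<bar>I\<^sub>1 t + I\<^sub>2 t\<bar> \<le> 2 * M + i"
            using bound(2,3)[of t] \<open>0 < t\<close> \<open>0 < i\<close> by auto
          then show ?thesis by (auto simp: abs_divide abs_mult intro!: divide_right_mono mult_left_mono)
        qed
        ultimately have "\<bar>d\<bar> \<le> (R * (2 * M + i)) / L\<^sub>2" using \<open>0 < M\<close> \<open>0 < i\<close> by auto
        with reg[folded d_def] show "\<exists>d. \<bar>d\<bar> \<le> (R * (2 * M + i)) / L\<^sub>2 \<and> (I\<^sub>2 has_real_derivative d) (at t)" by blast
      qed
    qed
  qed (use \<open>0 < M\<close> \<open>0 < i\<close> in auto)
  have lipI: "M-lipschitz_on {0..} I"
  proof (rule abs_continuous_lipschitz[OF ac(4)])
    show "AE x in lebesgue. 0 < x \<longrightarrow> (\<exists>d. \<bar>d\<bar> \<le> M \<and> (I has_real_derivative d) (at x))"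
      using regular
    proof eventually_elim
      case (elim t)
      show ?case
      proof
        assume "0 < t"
        with elim obtain \<nu> \<mu> where "regular t \<nu> \<mu>" by blast
        note reg = this[unfolded regular_def]
        define d where "d = V\<^sub>r\<^sub>e\<^sub>f - V\<^sub>C t - \<mu>"
        have "d = 0 \<or> d = V\<^sub>r\<^sub>e\<^sub>f - V\<^sub>C t"
          using reg unfolding d_def by auto
        then have "\<bar>d\<bar> \<le> M" using bound(1)[of t] \<open>0 < t\<close> \<open>0 < M\<close> by auto
        with reg[folded d_def] show "\<exists>d. \<bar>d\<bar> \<le> M \<and> (I has_real_derivative d) (at t)" by blast
      qed
    qed
  qed (use \<open>0 < M\<close> in auto)

  have "((\<lambda>t. V\<^sub>r\<^sub>e\<^sub>f * I\<^sub>2 t) \<longlongrightarrow> 0) at_top"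
  proof (rule nonneg_dissipation_tendsto_zero[OF acE E_lim])
    show "AE t in lebesgue. 0 < t \<longrightarrow> (\<exists>d\<le>- (V\<^sub>r\<^sub>e\<^sub>f * I\<^sub>2 t). (E has_real_derivative d) (at t))"
      using load_nonneg by (intro dissipation_le) simp
  qed (assumption, rule lipschitz_on_cmult_real[OF lip2], rule source_nonneg)
  from tendsto_mult_left[OF this, of "1 / V\<^sub>r\<^sub>e\<^sub>f"] have lim2: "(I\<^sub>2 \<longlongrightarrow> 0) at_top"
    using \<open>0 < i\<close> by (simp add: Vref)

  have lip12: "((M + R * (2 * M)) / L\<^sub>1 + 0 + R * (2 * M + i) / L\<^sub>2)-lipschitz_on {0..} (\<lambda>t. I\<^sub>1 t - i + I\<^sub>2 t)"
    by (intro lipschitz_on_add lipschitz_on_diff lipschitz_on_constant lip1 lip2)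
  have "((\<lambda>t. R * (I\<^sub>1 t - i + I\<^sub>2 t)\<^sup>2) \<longlongrightarrow> 0) at_top"
  proof (rule nonneg_dissipation_tendsto_zero[OF acE E_lim])
    show "AE t in lebesgue. 0 < t \<longrightarrow>
        (\<exists>d\<le>- (R * (I\<^sub>1 t - i + I\<^sub>2 t)\<^sup>2). (E has_real_derivative d) (at t))"
      using source_nonneg by (intro dissipation_le) simp
    have "(\<lambda>t. I\<^sub>1 t - i + I\<^sub>2 t) ` {0..} \<subseteq> {- (2 * M)..2 * M}"
    proof (rule image_subsetI)
      fix t :: real assume "t \<in> {0..}"
      then show "I\<^sub>1 t - i + I\<^sub>2 t \<in> {- (2 * M)..2 * M}" using bound(2,3)[of t] by auto
    qed
    then have "(2 * (2 * M))-lipschitz_on ((\<lambda>t. I\<^sub>1 t - i + I\<^sub>2 t) ` {0..}) (\<lambda>x. x\<^sup>2)"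
      using \<open>0 < M\<close> by (intro lipschitz_on_subset[OF lipschitz_on_power2]) auto
    from lipschitz_on_cmult_real[OF lipschitz_on_compose2[OF lip12 this]]
    show "(\<bar>R\<bar> * (2 * (2 * M) * ((M + R * (2 * M)) / L\<^sub>1 + 0 + R * (2 * M + i) / L\<^sub>2)))-lipschitz_on
        {0..} (\<lambda>t. R * (I\<^sub>1 t - i + I\<^sub>2 t)\<^sup>2)" .
  qed (use load_nonneg in auto)
  from tendsto_mult_left[OF this, of "1 / R"]
  have "((\<lambda>t. (I\<^sub>1 t - i + I\<^sub>2 t)\<^sup>2) \<longlongrightarrow> 0) at_top" by simp
  then have "((\<lambda>t. I\<^sub>1 t - i + I\<^sub>2 t) \<longlongrightarrow> 0) at_top" by (simp add: power_tendsto_0_iff)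
  from tendsto_add[OF tendsto_diff[OF this lim2] tendsto_const[of i]] have lim1: "(I\<^sub>1 \<longlongrightarrow> i) at_top" by simp

  have "((\<lambda>t. 1 / L\<^sub>1 * (V\<^sub>C t - R * (I\<^sub>1 t + I\<^sub>2 t))) \<longlongrightarrow> 0) at_top"
  proof (rule barbalat_abs_continuous[OF ac(2) lim1])
    show "AE t in lebesgue. 0 < t \<longrightarrow>
        (I\<^sub>1 has_real_derivative 1 / L\<^sub>1 * (V\<^sub>C t - R * (I\<^sub>1 t + I\<^sub>2 t))) (at t)"
      using regular by eventually_elim (auto simp: regular_def)
  qed (assumption, rule lipschitz_on_cmult_real[OF lipschitz_on_diff[OF lipV
      lipschitz_on_cmult_real[OF lipschitz_on_add[OF lip1 lip2]]]])
  from tendsto_mult_left[OF this, of L\<^sub>1]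
  have "((\<lambda>t. V\<^sub>C t - R * (I\<^sub>1 t + I\<^sub>2 t)) \<longlongrightarrow> 0) at_top" by simp
  from tendsto_add[OF this tendsto_mult_left[OF tendsto_add[OF lim1 lim2], of R]]
  have limV: "(V\<^sub>C \<longlongrightarrow> V\<^sub>r\<^sub>e\<^sub>f) at_top" by (simp add: Vref)

  have "((\<lambda>t. 1 / C * (I t - I\<^sub>1 t)) \<longlongrightarrow> 0) at_top"
  proof (rule barbalat_abs_continuous[OF ac(1) limV])
    show "AE t in lebesgue. 0 < t \<longrightarrow> (V\<^sub>C has_real_derivative 1 / C * (I t - I\<^sub>1 t)) (at t)"
      using regular by eventually_elim (auto simp: regular_def)
  qed (assumption, rule lipschitz_on_cmult_real[OF lipschitz_on_diff[OF lipI lip1]])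
  from tendsto_mult_left[OF this, of C]
  have "((\<lambda>t. I t - I\<^sub>1 t) \<longlongrightarrow> 0) at_top" by simp
  from tendsto_add[OF this lim1] have limI: "(I \<longlongrightarrow> i) at_top" by simp

  have "((\<lambda>t. (V\<^sub>C t, I\<^sub>1 t, I\<^sub>2 t, I t)) \<longlongrightarrow> (V\<^sub>r\<^sub>e\<^sub>f, i, 0, i)) at_top"
    by (intro tendsto_Pair limV lim1 lim2 limI)
  then show ?thesis using I_in_K \<open>K = _\<close> by (auto simp: i_def)
qed

end
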